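(* Fix $c\in(0,1)\cap\mathbb{Q}$, an epistemic neighborhood model $\mathcal{M}$, and an epistemic probability model $\mathcal{M}'$. If $\mathcal{M}$ and $\mathcal{M}'$ agree for threshold $c$, then for each world $w$ and each $\varphi \in \mathcal{L}_{KB}$ we have \[ \mathcal{M},w\models_N\varphi \quad\text{iff}\quad \mathcal{M}',w\models_P\varphi^c\enspace. \]
   Context: Fix a set $\mathsf{Prop}$ of propositional letters. An epistemic probability model is $\mathcal{M}'=(W,R,V,P)$ where $W$ is a finite nonempty set of worlds, $R$ is an equivalence relation on $W$ with classes $[w]=\{v\mid wRv\}$, $V:W\to\wp(\mathsf{Prop})$, and $P$ is a probability measure on $\wp(W)$ with full support ($P(\{w\})\neq 0$ for all $w$); set $P_w(X):=P(X\cap[w])/P([w])$. An epistemic neighborhood model is $\mathcal{M}=(W,R,V,N)$ with $(W,R,V)$ as before and $N:W\to\wp(\wp(W))$ such that for all $w$: every $X\in N(w)$ satisfies $X\subseteq[w]$; $\emptyset\notin N(w)$; $[w]\in N(w)$; $N(v)=N(w)$ for $v\in[w]$; and if $X\subseteq Y\subseteq[w]$ and $X\in N(w)$ then $Y\in N(w)$. The language $\mathcal{L}_{KB}$ is $\varphi::=\top\mid p\mid\neg\varphi\mid\varphi\land\varphi\mid K\varphi\mid B\varphi$ ($p\in\mathsf{Prop}$). Its neighborhood semantics: Boolean clauses as usual, $\mathcal{M},w\models_N K\varphi$ iff $[w]\subseteq[\![\varphi]\!]_N$, and $\mathcal{M},w\models_N B\varphi$ iff $[w]\cap[\![\varphi]\!]_N\in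 N(w)$, where $[\![\varphi]\!]_N=\{v\mid \mathcal{M},v\models_N\varphi\}$. The probability language $\mathcal{L}$ is $\varphi::=\top\mid p\mid\neg\varphi\mid\varphi\land\varphi\mid t\geq 0$ with terms $t::=q\mid q\cdot P(\varphi)\mid t+t$ ($q\in\mathbb{Q}$); in $\mathcal{M}'$, $\mathcal{M}',w\models_P t\geq 0$ iff the value of $t$ at $w$ is $\geq 0$, where $q\cdot P(\varphi)$ is evaluated as $q\cdot P_w([\![\varphi]\!]_P)$ (Boolean clauses as usual). The translation $\varphi\mapsto\varphi^c$ from $\mathcal{L}_{KB}$ to $\mathcal{L}$ is identity on $\top$ and letters, commutes with $\neg,\land$, and sets $(K\varphi)^c:=(P(\varphi^c)=1)$ and $(B\varphi)^c:=(P(\varphi^c)>c)$. $\mathcal{M}'=(W',R',V',P')$ agrees with $\mathcal{M}=(W,R,V,N)$ for threshold $c$ iff $(W',R',V')=(W,R,V)$, $P'$ has full support, and for each $w\in W$ and $X\subseteq[w]$: $X\in N(w)$ iff $P'_w(X)>c$. *)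

theory Defs
  imports "HOL-Probability.Probability"
begin

record ('w, 'p) epistemic_model =
  worlds :: "'w set"
  acc :: "'w rel"
  val :: "'w \<Rightarrow> 'p set"

record ('w, 'p) nbhd_model = "('w, 'p) epistemic_model" +
  nbhd :: "'w \<Rightarrow> 'w set set"

record ('w, 'p) prob_model = "('w, 'p) epistemic_model" +
  pmeasure :: "'w measure"

text \<open>
  \<open>nbhd\<close> and \<open>val\<close> are total functions, but only their values on \<open>worlds M\<close> matter.
\<close>

definition epistemic_frame :: "('w, 'p, 'm) epistemic_model_scheme \<Rightarrow> bool" where
  "epistemic_frame M \<longleftrightarrow>
     finite (worlds M) \<and> worlds M \<noteq> {} \<and> equiv (worlds M) (acc M)"

definition cell :: "('w, 'p, 'm) epistemic_model_scheme \<Rightarrow> 'w \<Rightarrow> 'w set" where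
  "cell M w = {v. (w, v) \<in> acc M}"

definition epistemic_nbhd_model :: "('w, 'p) nbhd_model \<Rightarrow> bool" where
  "epistemic_nbhd_model M \<longleftrightarrow>
     epistemic_frame M \<and>
     (\<forall>w \<in> worlds M.
        (\<forall>X \<in> nbhd M w. X \<subseteq> cell M w) \<and>
        {} \<notin> nbhd M w \<and>
        cell M w \<in> nbhd M w \<and>
        (\<forall>v \<in> cell M w. nbhd M v = nbhd M w) \<and>
        (\<forall>X Y. X \<subseteq> Y \<and> Y \<subseteq> cell M w \<and> X \<in> nbhd M w \<longrightarrow> Y \<in> nbhd M w))"

definition full_support :: "('w, 'p) prob_model \<Rightarrow> bool" where
  "full_support M \<longleftrightarrow> (\<forall>w \<in> worlds M. measure (pmeasure M) {w} \<noteq> 0)"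

definition epistemic_prob_model :: "('w, 'p) prob_model \<Rightarrow> bool" where
  "epistemic_prob_model M \<longleftrightarrow>
     epistemic_frame M \<and>
     prob_space (pmeasure M) \<and>
     space (pmeasure M) = worlds M \<and> sets (pmeasure M) = Pow (worlds M) \<and>
     full_support M"

definition local_prob :: "('w, 'p) prob_model \<Rightarrow> 'w \<Rightarrow> 'w set \<Rightarrow> real" where
  "local_prob M w X =
     measure (pmeasure M) (X \<inter> cell M w) / measure (pmeasure M) (cell M w)"

datatype 'p kb_form =
    KBTop
  | KBLetter 'p
  | KBNeg "'p kb_form"
  | KBConj "'p kb_form" "'p kb_form"
  | Know "'p kb_form"
  | Bel "'p kb_form"

primrec sat_N :: "('w, 'p) nbhd_model \<Rightarrow> 'w \<Rightarrow> 'p kb_form \<Rightarrow> bool" where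
  "sat_N M w KBTop \<longleftrightarrow> True"
| "sat_N M w (KBLetter p) \<longleftrightarrow> p \<in> val M w"
| "sat_N M w (KBNeg \<phi>) \<longleftrightarrow> \<not> sat_N M w \<phi>"
| "sat_N M w (KBConj \<phi> \<psi>) \<longleftrightarrow> sat_N M w \<phi> \<and> sat_N M w \<psi>"
| "sat_N M w (Know \<phi>) \<longleftrightarrow> cell M w \<subseteq> {v \<in> worlds M. sat_N M v \<phi>}"
| "sat_N M w (Bel \<phi>) \<longleftrightarrow> cell M w \<inter> {v \<in> worlds M. sat_N M v \<phi>} \<in> nbhd M w"

datatype 'p pr_form =
    PTop
  | PLetter 'p
  | PNeg "'p pr_form"
  | PConj "'p pr_form" "'p pr_form"
  | GeqZero "'p pr_term"
and 'p pr_term =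
    TConst rat
  | TProb rat "'p pr_form"
  | TPlus "'p pr_term" "'p pr_term"

primrec sat_P :: "('w, 'p) prob_model \<Rightarrow> 'w \<Rightarrow> 'p pr_form \<Rightarrow> bool"
  and term_val :: "('w, 'p) prob_model \<Rightarrow> 'w \<Rightarrow> 'p pr_term \<Rightarrow> real" where
  "sat_P M w PTop \<longleftrightarrow> True"
| "sat_P M w (PLetter p) \<longleftrightarrow> p \<in> val M w"
| "sat_P M w (PNeg \<phi>) \<longleftrightarrow> \<not> sat_P M w \<phi>"
| "sat_P M w (PConj \<phi> \<psi>) \<longleftrightarrow> sat_P M w \<phi> \<and> sat_P M w \<psi>"
| "sat_P M w (GeqZero t) \<longleftrightarrow> term_val M w t \<ge> 0"
| "term_val M w (TConst q) = of_rat q"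
| "term_val M w (TProb q \<phi>) = of_rat q * local_prob M w {v \<in> worlds M. sat_P M v \<phi>}"
| "term_val M w (TPlus s t) = term_val M w s + term_val M w t"

text \<open>
  The only primitive comparison is \<open>t \<ge> 0\<close>; the other ones are the usual abbreviations, with
  negation of terms pushed down to the rational coefficients.
\<close>

primrec term_neg :: "'p pr_term \<Rightarrow> 'p pr_term" where
  "term_neg (TConst q) = TConst (- q)"
| "term_neg (TProb q \<phi>) = TProb (- q) \<phi>"
| "term_neg (TPlus s t) = TPlus (term_neg s) (term_neg t)"

definition PGeq :: "'p pr_term \<Rightarrow> 'p pr_term \<Rightarrow> 'p pr_form" where
  "PGeq s t = GeqZero (TPlus s (term_neg t))"

definition PEq :: "'p pr_term \<Rightarrow> 'p pr_term \<Rightarrow> 'p pr_form" where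
  "PEq s t = PConj (PGeq s t) (PGeq t s)"

definition PGreater :: "'p pr_term \<Rightarrow> 'p pr_term \<Rightarrow> 'p pr_form" where
  "PGreater s t = PNeg (PGeq t s)"

primrec translate :: "rat \<Rightarrow> 'p kb_form \<Rightarrow> 'p pr_form" where
  "translate c KBTop = PTop"
| "translate c (KBLetter p) = PLetter p"
| "translate c (KBNeg \<phi>) = PNeg (translate c \<phi>)"
| "translate c (KBConj \<phi> \<psi>) = PConj (translate c \<phi>) (translate c \<psi>)"
| "translate c (Know \<phi>) = PEq (TProb 1 (translate c \<phi>)) (TConst 1)"
| "translate c (Bel \<phi>) = PGreater (TProb 1 (translate c \<phi>)) (TConst c)"

text \<open>
  Valuations are functions on the set of worlds, so their equality is equality on \<open>worlds M\<close>.
\<close>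

definition agrees :: "rat \<Rightarrow> ('w, 'p) prob_model \<Rightarrow> ('w, 'p) nbhd_model \<Rightarrow> bool" where
  "agrees c M' M \<longleftrightarrow>
     worlds M' = worlds M \<and> acc M' = acc M \<and> (\<forall>w \<in> worlds M. val M' w = val M w) \<and>
     full_support M' \<and>
     (\<forall>w \<in> worlds M. \<forall>X. X \<subseteq> cell M w \<longrightarrow>
        (X \<in> nbhd M w \<longleftrightarrow> local_prob M' w X > of_rat c))"

end

theory Submission
  imports Defs
begin

text \<open>
  The modal clause for \<open>Know\<close> is where full support enters: a subset of a cell has local
  probability \<open>1\<close> only if its complement in the cell is null, hence empty. The clause for
  \<open>Bel\<close> is the agreement condition itself.
\<close>

lemma term_val_term_neg: "term_val M w (term_neg t) = - term_val M w t"
  \<comment> \<open>Terms and formulas are mutually recursive, so the rule also needs a predicate on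
    formulas. The trivial one suffices, because \<open>term_neg\<close> changes only
    coefficients.\<close>
  by (induction t rule: pr_term.induct[where ?P1.0 = "\<lambda>_. True"]) (simp_all add: of_rat_minus)

lemma sat_P_PEq: "sat_P M w (PEq s t) \<longleftrightarrow> term_val M w s = term_val M w t"
  by (auto simp: PEq_def PGeq_def term_val_term_neg)

lemma sat_P_PGreater: "sat_P M w (PGreater s t) \<longleftrightarrow> term_val M w s > term_val M w t"
  by (auto simp: PGreater_def PGeq_def term_val_term_neg)

lemma cell_subset_worlds:
  assumes "epistemic_frame M"
  shows "cell M w \<subseteq> worlds M"
  using assms by (auto simp: epistemic_frame_def cell_def equiv_def refl_on_def)

lemma mem_cell_self:
  assumes "epistemic_frame M" and "w \<in> worlds M"
  shows "w \<in> cell M w"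
  using assms by (auto simp: epistemic_frame_def cell_def equiv_def refl_on_def)

text \<open>Full support gives each singleton positive mass, and monotonicity passes this on to any
  set of worlds containing it; all such sets are measurable.\<close>

lemma measure_pos_iff_nonempty:
  assumes "epistemic_prob_model M" and "X \<subseteq> worlds M"
  shows "measure (pmeasure M) X > 0 \<longleftrightarrow> X \<noteq> {}"
proof
  assume "X \<noteq> {}"
  then obtain v where v: "v \<in> X" by blast
  interpret prob_space "pmeasure M"
    using assms(1) by (simp add: epistemic_prob_model_def)
  have "0 < measure (pmeasure M) {v}"
    using assms v by (auto simp: epistemic_prob_model_def full_support_def zero_less_measure_iff)
  also have "\<dots> \<le> measure (pmeasure M) X"
    using assms v by (intro finite_measure_mono) (auto simp: epistemic_prob_model_def)
  finally show "measure (pmeasure M) X > 0" .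
qed auto

lemma local_prob_eq_1_iff:
  assumes "epistemic_prob_model M" and "w \<in> worlds M"
  shows "local_prob M w X = 1 \<longleftrightarrow> cell M w \<subseteq> X"
proof -
  interpret prob_space "pmeasure M"
    using assms(1) by (simp add: epistemic_prob_model_def)
  have frame: "epistemic_frame M" and sets: "sets (pmeasure M) = Pow (worlds M)"
    using assms(1) by (auto simp: epistemic_prob_model_def)
  have cell: "cell M w \<subseteq> worlds M"
    using frame by (rule cell_subset_worlds)
  \<comment> \<open>The denominator of \<open>local_prob\<close> is nonzero, so the value 1 means
    that numerator and denominator coincide.\<close>
  have pos: "measure (pmeasure M) (cell M w) > 0"
    using measure_pos_iff_nonempty[OF assms(1) cell] mem_cell_self[OF frame assms(2)] by blast
  have "measure (pmeasure M) (cell M w - X \<inter> cell M w) =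
      measure (pmeasure M) (cell M w) - measure (pmeasure M) (X \<inter> cell M w)"
    using cell by (intro finite_measure_Diff) (auto simp: sets)
  \<comment> \<open>Being null is phrased as not being positive, to match the criterion for
    nonemptiness.\<close>
  then have "local_prob M w X = 1 \<longleftrightarrow> \<not> measure (pmeasure M) (cell M w - X \<inter> cell M w) > 0"
    using pos measure_nonneg[of "pmeasure M" "cell M w - X \<inter> cell M w"]
    by (simp add: local_prob_def) linarith
  also have "\<dots> \<longleftrightarrow> cell M w - X \<inter> cell M w = {}"
    using measure_pos_iff_nonempty[OF assms(1), of "cell M w - X \<inter> cell M w"] cell by blast
  finally show ?thesis by blast
qed

text \<open>Agreement speaks only of subsets of the cell, while the translation of
  \<open>Bel\<close> measures the whole truth set; conditioning on the cell hides the
  difference.\<close>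

lemma local_prob_Int_cell: "local_prob M w (cell M w \<inter> X) = local_prob M w X"
  by (simp add: local_prob_def Int_ac)

theorem mainTheorem3:
  fixes c :: rat
    and M :: "('w, 'p) nbhd_model"
    and M' :: "('w, 'p) prob_model"
    and w :: 'w
    and \<phi> :: "'p kb_form"
  assumes "0 < c" and "c < 1"
    and "epistemic_nbhd_model M"
    and "epistemic_prob_model M'"
    and "agrees c M' M"
    and "w \<in> worlds M"
  shows "sat_N M w \<phi> \<longleftrightarrow> sat_P M' w (translate c \<phi>)"
proof -
  have worlds: "worlds M' = worlds M" and cell: "\<And>v. cell M' v = cell M v"
    using assms(5) by (auto simp: agrees_def cell_def)
  \<comment> \<open>Modal clauses depend on a subformula only through its truth set, so equivalence
    at every world is what they need from the induction.\<close>
  have ext: "{v \<in> worlds M. sat_N M v \<psi>} = {v \<in> worlds M'. sat_P M' v (translate c \<psi>)}"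
    if "\<And>v. v \<in> worlds M \<Longrightarrow> sat_N M v \<psi> \<longleftrightarrow> sat_P M' v (translate c \<psi>)" for \<psi>
    using that worlds by auto
  show ?thesis
    using assms(6)
  \<comment> \<open>The world must vary, since \<open>ext\<close> uses the induction hypothesis at
    all of \<open>worlds M\<close>.\<close>
  proof (induction \<phi> arbitrary: w)
    case (KBLetter p)
    then show ?case
      using assms(5) by (simp add: agrees_def)
  next
    case (Know \<phi>)
    then have "w \<in> worlds M'" by (simp add: worlds)
    then show ?case
      using local_prob_eq_1_iff[OF assms(4)] ext[OF Know.IH]
      by (simp add: sat_P_PEq cell)
  next
    case (Bel \<phi>)
    let ?X = "{v \<in> worlds M. sat_N M v \<phi>}"
    have "cell M w \<inter> ?X \<in> nbhd M w \<longleftrightarrow> local_prob M' w (cell M w \<inter> ?X) > of_rat c"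
      using assms(5) Bel.prems by (auto simp: agrees_def)
    then show ?case
      using local_prob_Int_cell[of M' w ?X] ext[OF Bel.IH]
      by (simp add: sat_P_PGreater cell)
  qed simp_all
qed

end
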